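(* Let $n\ge 1$. For any closed convex cone $\mathcal{K}\subseteq\mathcal{S}^n$ with $\mathcal{CP}^n\subseteq\mathcal{K}\subseteq\mathcal{DNN}^n$, we have $\ell_{\mathcal{K}}=T_n+1$ and $$\ell_{\rm poly}(\mathcal{K})=\begin{cases}0 & (n=1),\\ T_n-2 & (n\ge 2).\end{cases}$$
   Context: $\mathcal{S}^n$ is the space of real $n\times n$ symmetric matrices and $T_n:=\frac{n(n+1)}{2}$. A set $\mathcal{K}\subseteq\mathcal{S}^n$ is a cone if $\alpha A\in\mathcal{K}$ for all $\alpha\ge 0$ and $A\in\mathcal{K}$. $\mathbb{R}_+^n$ is the set of $n$-dimensional nonnegative real vectors. The completely positive cone is $\mathcal{CP}^n:=\{\sum_{i=1}^m a_ia_i^\top : a_i\in\mathbb{R}_+^n\text{ for all }i=1,\dots,m\}$ (with $m$ an arbitrary finite number). The doubly nonnegative cone is $\mathcal{DNN}^n:=\mathcal{S}_+^n\cap\mathcal{N}^n$, where $\mathcal{S}_+^n$ is the set of positive semidefinite matrices in $\mathcal{S}^n$ and $\mathcal{N}^n$ is the set of matrices in $\mathcal{S}^n$ with only nonnegative elements. A nonempty convex subcone $\mathcal{F}$ of a closed convex cone $\mathcal{K}$ is a face of $\mathcal{K}$ if for any $A,B\in\mathcal{K}$, $A+B\in\mathcal{F}$ implies $A,B\in\mathcal{F}$. A chain of faces of $\mathcal{K}$ of length $l$ is a sequence $\mathcal{F}_l\subsetneq\cdots\subsetneq\mathcal{F}_1$ in which every $\mathcal{F}_i$ is a face of $\mathcal{K}$.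 $\ell_{\mathcal{K}}$ denotes the length of the longest chain of faces of $\mathcal{K}$. The distance to polyhedrality $\ell_{\rm poly}(\mathcal{K})$ is the length minus one of the longest chain $\mathcal{F}_l\subsetneq\cdots\subsetneq\mathcal{F}_1$ of faces of $\mathcal{K}$ such that $\mathcal{F}_l$ is polyhedral and every $\mathcal{F}_i$ with $i<l$ is not polyhedral. *)

theory Defs
  imports "HOL-Analysis.Analysis" "HOL-Library.Extended_Nat"
begin

definition sym_mats :: "(real^'n^'n) set" where
  "sym_mats = {A. transpose A = A}"

definition psd_cone :: "(real^'n^'n) set" where
  "psd_cone = {A \<in> sym_mats. \<forall>x. 0 \<le> x \<bullet> (A *v x)}"

definition nonneg_mats :: "(real^'n^'n) set" where
  "nonneg_mats = {A \<in> sym_mats. \<forall>i j. 0 \<le> A $ i $ j}"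

definition dnn_cone :: "(real^'n^'n) set" where
  "dnn_cone = psd_cone \<inter> nonneg_mats"

(* The matrix a a^T. *)
definition self_outer :: "real^'n \<Rightarrow> real^'n^'n" where
  "self_outer a = (\<chi> i j. a $ i * a $ j)"

definition nonneg_vecs :: "(real^'n) set" where
  "nonneg_vecs = {a. \<forall>i. 0 \<le> a $ i}"

definition cp_cone :: "(real^'n^'n) set" where
  "cp_cone = {(\<Sum>i=1..m. self_outer (a i)) | (m::nat) a. \<forall>i\<in>{1..m}. a i \<in> nonneg_vecs}"

definition triangular :: "nat \<Rightarrow> nat" where
  "triangular n = n * (n + 1) div 2"

(* Unlike face_of, this excludes the empty set and requires F to be a cone. *)
definition cone_face :: "'a::real_vector set \<Rightarrow> 'a set \<Rightarrow> bool" where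
  "cone_face F K \<longleftrightarrow> F \<noteq> {} \<and> convex F \<and> cone F \<and> F \<subseteq> K \<and>
     (\<forall>A\<in>K. \<forall>B\<in>K. A + B \<in> F \<longrightarrow> A \<in> F \<and> B \<in> F)"

(* A chain F l \<subset> ... \<subset> F 1; only the values of F on {1..l} matter. *)
definition face_chain :: "'a::real_vector set \<Rightarrow> nat \<Rightarrow> (nat \<Rightarrow> 'a set) \<Rightarrow> bool" where
  "face_chain K l F \<longleftrightarrow> 1 \<le> l \<and> (\<forall>i\<in>{1..l}. cone_face (F i) K) \<and>
     (\<forall>i\<in>{1..<l}. F (Suc i) \<subset> F i)"

(* The two maximal lengths are taken in enat, so that they are infinite when chains are
   unboundedly long; a finite value of either supremum over a nonempty set is attained. *)
definition longest_chain :: "'a::real_vector set \<Rightarrow> enat" where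
  "longest_chain K = Sup {enat l | l. \<exists>F. face_chain K l F}"

(* The supremum is over a nonempty set for every closed convex cone K \<noteq> {} in Euclidean
   space: the least face of K is its lineality space, which is polyhedral. *)
definition poly_distance :: "'a::euclidean_space set \<Rightarrow> enat" where
  "poly_distance K = Sup {enat l | l. \<exists>F. face_chain K l F \<and> polyhedron (F l) \<and>
     (\<forall>i\<in>{1..<l}. \<not> polyhedron (F i))} - 1"

end

(* Every entry is nonnegative on K, so the vanishing of a set of entries cuts out a face of K.
   Killing the positions one after the other, where an off-diagonal position (i,j) goes before the
   diagonal positions (i,i) and (j,j), gives T_n + 1 faces: consecutive ones are separated by
   (e_i + e_j)(e_i + e_j)^T or e_i e_i^T. No chain is longer, since the dimension drops
   strictly along a chain of faces.
   If (a,b), (a,a), (b,b) are killed last, then all faces up to the three-dimensional one contain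
   the matrices (e_a + s e_b)(e_a + s e_b)^T with s > 0, which lie on pairwise different
   exposed faces; such a face is not polyhedral. Conversely, closed faces of dimension at most two
   are polyhedral, because their compact slice by the hyperplane where the entries sum to 1 is
   a segment. *)
theory Submission
  imports Defs
begin

section \<open>Chains of faces and dimension\<close>

text \<open>Scaling inside the cone turns a point of an open segment into a sum of two elements of
  \<open>K\<close>, to which the additive face condition applies. This gives access to the library
  facts on dimension and closedness of faces.\<close>

lemma cone_face_imp_face_of:
  assumes "cone K" and F: "cone_face F K"
  shows "F face_of K"
  unfolding face_of_def
proof (intro conjI ballI impI)
  show "F \<subseteq> K" "convex F"
    using F by (auto simp: cone_face_def)
  have both: "x \<in> F" if "x \<in> K" "y \<in> K" "u *\<^sub>R x + v *\<^sub>R y \<in> F" "0 < u" "0 < v" for x y u v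
  proof -
    have "u *\<^sub>R x \<in> K" "v *\<^sub>R y \<in> K"
      using that \<open>cone K\<close> by (auto simp: cone_def)
    then have "u *\<^sub>R x \<in> F"
      using F that unfolding cone_face_def by blast
    then have "inverse u *\<^sub>R (u *\<^sub>R x) \<in> F"
      using F \<open>0 < u\<close> unfolding cone_face_def cone_def by (meson inverse_nonnegative_iff_nonnegative less_imp_le)
    then show ?thesis
      using \<open>0 < u\<close> by simp
  qed
  fix a b x
  assume ab: "a \<in> K" "b \<in> K" and x: "x \<in> F" "x \<in> open_segment a b"
  then obtain u where u: "0 < u" "u < 1" "x = (1 - u) *\<^sub>R a + u *\<^sub>R b"
    by (auto simp: in_segment)
  show "a \<in> F"
    using both[of a b "1 - u" u] ab u x by auto
  show "b \<in> F"
    using both[of b a u "1 - u"] ab u x by (auto simp: add.commute)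
qed

text \<open>Consecutive members are faces of each other, and a proper face of a convex set has
  strictly smaller dimension. So each of the \<open>i\<close> inclusions between \<open>F 1\<close>
  and \<open>F (Suc i)\<close> costs at least one.\<close>

lemma face_chain_aff_dim:
  fixes K :: "'a::euclidean_space set"
  assumes "convex K" "cone K" and F: "face_chain K l F" and "Suc i \<le> l"
  shows "aff_dim (F (Suc i)) + int i \<le> aff_dim K"
  using \<open>Suc i \<le> l\<close>
proof (induction i)
  case 0
  then have "F 1 \<subseteq> K"
    using F unfolding face_chain_def cone_face_def by auto
  then show ?case
    by (simp add: aff_dim_subset)
next
  case (Suc i)
  have fc: "cone_face (F (Suc i)) K" "cone_face (F (Suc (Suc i))) K"
    and ss: "F (Suc (Suc i)) \<subset> F (Suc i)"
    using F Suc.prems unfolding face_chain_def by auto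
  have sub: "convex (F (Suc i))" "F (Suc i) \<subseteq> K"
    using fc(1) by (simp_all add: cone_face_def)
  have "F (Suc (Suc i)) face_of F (Suc i)"
    by (rule face_of_subset[OF cone_face_imp_face_of[OF \<open>cone K\<close> fc(2)] psubset_imp_subset[OF ss] sub(2)])
  then have "aff_dim (F (Suc (Suc i))) < aff_dim (F (Suc i))"
    using face_of_aff_dim_lt[OF sub(1)] ss by blast
  then show ?case
    using Suc.IH Suc.prems by simp
qed

text \<open>The bound by \<open>a\<close> keeps the functional positive away from the origin and
  makes its slice at height 1 a compact base of \<open>C\<close>. That base is at most
  one-dimensional, so the endpoints of a segment generate \<open>C\<close>.\<close>

lemma polyhedron_cone_aff_dim_le_2:
  fixes C :: "'a::euclidean_space set"
  assumes C: "closed C" "convex C" "cone C" and pos: "\<And>x. x \<in> C \<Longrightarrow> norm x \<le> a \<bullet> x"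
    and dim: "aff_dim C \<le> 2"
  shows "polyhedron C"
proof (cases "C \<subseteq> {0}")
  case True
  then have "C = {} \<or> C = {0}"
    by auto
  then show ?thesis
    by (auto simp: polytope_sing polytope_imp_polyhedron)
next
  case False
  then obtain x where x: "x \<in> C" "x \<noteq> 0"
    by auto
  define S where "S = C \<inter> {x. a \<bullet> x = 1}"
  have normalize: "(1 / (a \<bullet> y)) *\<^sub>R y \<in> S" "0 < a \<bullet> y" if "y \<in> C" "y \<noteq> 0" for y
  proof -
    show "0 < a \<bullet> y"
      using pos[OF that(1)] that(2) by (meson less_le_trans zero_less_norm_iff)
    then show "(1 / (a \<bullet> y)) *\<^sub>R y \<in> S"
      using that \<open>cone C\<close> unfolding S_def cone_def by auto
  qed
  have "S \<noteq> {}"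
    using normalize x by auto
  moreover have "compact S"
  proof -
    have "S \<subseteq> cball 0 1"
      using pos by (force simp: S_def)
    then have "bounded S"
      using bounded_cball bounded_subset by blast
    moreover have "closed S"
      unfolding S_def by (intro closed_Int \<open>closed C\<close> closed_hyperplane)
    ultimately show ?thesis
      by (simp add: compact_eq_bounded_closed)
  qed
  moreover have "convex S"
    unfolding S_def by (intro convex_Int \<open>convex C\<close> convex_hyperplane)
  moreover have "collinear S"
  \<comment> \<open>The affine hull of \<open>C\<close> contains 0 but the hyperplane does not, so
    the slice has smaller dimension than \<open>C\<close>.\<close>
  proof -
    have "0 \<in> affine hull C"
      using x \<open>cone C\<close> by (auto simp: cone_def intro!: hull_inc) (metis order_refl scale_zero_left)
    moreover have "affine hull S \<subseteq> {x. a \<bullet> x = 1}"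
      by (intro hull_minimal affine_hyperplane) (auto simp: S_def)
    moreover have "affine hull S \<subseteq> affine hull C"
      by (intro hull_mono) (auto simp: S_def)
    ultimately have "affine hull S \<subset> affine hull C"
      by force
    then show ?thesis
      using aff_dim_psubset[of S C] dim by (simp add: collinear_aff_dim)
  qed
  ultimately obtain u v where uv: "S = closed_segment u v"
    using compact_convex_collinear_segment by metis
  let ?H = "convex_cone hull {u, v}"
  have H: "convex_cone ?H"
    by (rule convex_cone_convex_cone_hull)
  have "S \<subseteq> ?H"
    unfolding uv segment_convex_hull
    by (intro hull_minimal convex_convex_cone_hull) (auto intro: hull_inc)
  have "C \<subseteq> ?H"
  proof
    fix y assume "y \<in> C"
    show "y \<in> ?H"
    proof (cases "y = 0")
      case True
      then show ?thesis using convex_cone_contains_0[OF H] by simp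
    next
      case False
      then have "(1 / (a \<bullet> y)) *\<^sub>R y \<in> ?H" "0 \<le> a \<bullet> y"
        using normalize[OF \<open>y \<in> C\<close>] \<open>S \<subseteq> ?H\<close> by (auto simp: less_imp_le)
      then have "(a \<bullet> y) *\<^sub>R ((1 / (a \<bullet> y)) *\<^sub>R y) \<in> ?H"
        by (rule convex_cone_scaleR[OF H, rotated])
      then show ?thesis
        using normalize[OF \<open>y \<in> C\<close> False] by simp
    qed
  qed
  moreover have "?H \<subseteq> C"
  proof (rule hull_minimal)
    show "{u, v} \<subseteq> C"
      using uv by (auto simp: S_def)
    show "convex_cone C"
      using C x by (auto simp: convex_cone_def conic_def cone_def)
  qed
  ultimately have "C = ?H"
    by blast
  then show ?thesis
    by (metis finite.emptyI finite.insertI polyhedron_convex_cone_hull)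
qed

section \<open>Symmetric matrices\<close>

lemma sym_matsD: "A \<in> sym_mats \<Longrightarrow> A $ i $ j = A $ j $ i"
  by (auto simp: sym_mats_def transpose_def vec_eq_iff)

text \<open>A set \<open>{i, j}\<close> stands for the positions (i,j) and (j,i), a singleton for a
  diagonal position. These sets index a spanning set of the symmetric matrices and also the
  positions to be killed.\<close>

lemma card_positions: "card {s :: 'n::finite set. card s = 1 \<or> card s = 2} = triangular CARD('n)"
proof -
  have k: "card {s :: 'n set. card s = k} = CARD('n) choose k" for k
    using n_subsets[of "UNIV :: 'n set" k] by simp
  have "{s :: 'n set. card s = 1 \<or> card s = 2} = {s. card s = 1} \<union> {s. card s = 2}"
    by auto
  then have "card {s :: 'n set. card s = 1 \<or> card s = 2}
      = card {s :: 'n set. card s = 1} + card {s :: 'n set. card s = 2}"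
    by (simp only:) (rule card_Un_disjoint; auto)
  also have "\<dots> = CARD('n) + CARD('n) * (CARD('n) - 1) div 2"
    unfolding k choose_two by simp
  also have "\<dots> = triangular CARD('n)"
    by (cases "CARD('n)") (auto simp: triangular_def)
  finally show ?thesis .
qed

lemma pair_position: "card {i, j} = 1 \<or> card {i, j} = 2"
  by (cases "i = j") auto

lemma aff_dim_sym_mats: "aff_dim (sym_mats :: (real^'n^'n) set) \<le> int (triangular CARD('n))"
proof -
  let ?P = "{s :: 'n set. card s = 1 \<or> card s = 2}"
  define E :: "'n set \<Rightarrow> real^'n^'n" where "E s = (\<chi> i j. if {i, j} = s then 1 else 0)" for s
  have "A \<in> span (E ` ?P)" if A: "A \<in> sym_mats" for A :: "real^'n^'n"
  proof -
    \<comment> \<open>By symmetry of \<open>A\<close> the chosen value does not depend on the order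
      of the pair.\<close>
    define c where "c s = (SOME x. \<exists>i j. s = {i, j} \<and> x = A $ i $ j)" for s
    have c: "c {i, j} = A $ i $ j" for i j
      unfolding c_def by (rule some_equality) (auto simp: doubleton_eq_iff sym_matsD[OF A])
    have "A = (\<Sum>s\<in>?P. c s *\<^sub>R E s)"
    proof (simp only: vec_eq_iff, intro allI)
      fix i j
      have "(\<Sum>s\<in>?P. c s *\<^sub>R E s) $ i $ j = (\<Sum>s\<in>?P. if {i, j} = s then c s else 0)"
        unfolding sum_component by (rule sum.cong) (auto simp: E_def)
      also have "\<dots> = c {i, j}"
        using pair_position[of i j] by (subst sum.delta') auto
      finally show "A $ i $ j = (\<Sum>s\<in>?P. c s *\<^sub>R E s) $ i $ j"
        by (simp add: c)
    qed
    also have "\<dots> \<in> span (E ` ?P)"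
      by (intro span_sum span_scale span_base) auto
    finally show ?thesis .
  qed
  then have "dim (sym_mats :: (real^'n^'n) set) \<le> card (E ` ?P)"
    by (intro dim_le_card) auto
  also have "\<dots> \<le> card ?P"
    by (rule card_image_le) simp
  finally have "dim (sym_mats :: (real^'n^'n) set) \<le> triangular CARD('n)"
    by (simp only: card_positions)
  \<comment> \<open>Since 0 lies in the affine hull, affine and linear dimension agree.\<close>
  moreover have "0 \<in> affine hull (sym_mats :: (real^'n^'n) set)"
    by (rule hull_inc) (simp add: sym_mats_def transpose_def vec_eq_iff)
  ultimately show ?thesis
    by (simp add: aff_dim_zero)
qed

section \<open>Linear functionals on symmetric matrices\<close>

lemma norm_le_sum_entries:
  assumes "A \<in> nonneg_mats"
  shows "norm A \<le> (\<chi> i j. 1) \<bullet> A"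
proof -
  have "norm A \<le> (\<Sum>i\<in>UNIV. norm (A $ i))"
    by (simp add: norm_vec_def L2_set_le_sum)
  also have "\<dots> \<le> (\<Sum>i\<in>UNIV. \<Sum>j\<in>UNIV. \<bar>A $ i $ j\<bar>)"
    by (intro sum_mono norm_le_l1_cart)
  \<comment> \<open>For nonnegative entries the entrywise l1 norm is linear: it is the inner product
    with the all-ones matrix.\<close>
  also have "\<dots> = (\<chi> i j. 1) \<bullet> A"
    using assms by (simp add: inner_vec_def nonneg_mats_def)
  finally show ?thesis .
qed

text \<open>Turns positive semidefiniteness into one linear inequality in \<open>A\<close> for each
  \<open>w\<close>, which supplies supporting hyperplanes.\<close>

lemma quadratic_form_eq_inner: "w \<bullet> (A *v w) = self_outer w \<bullet> A"
  by (simp add: inner_vec_def matrix_vector_mult_def self_outer_def sum_distrib_left mult_ac)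

lemma inner_self_outer: "self_outer w \<bullet> self_outer a = (w \<bullet> a)\<^sup>2"
  by (simp add: inner_vec_def self_outer_def power2_eq_square sum_product mult_ac)

lemma self_outer_in_cp_cone: "a \<in> nonneg_vecs \<Longrightarrow> self_outer a \<in> cp_cone"
  unfolding cp_cone_def mem_Collect_eq
  by (rule exI[of _ 1], rule exI[of _ "\<lambda>_. a"]) auto

text \<open>A polyhedron has only finitely many faces, whereas here every s > 0 yields a different
  exposed face of \<open>F\<close>.\<close>

lemma not_polyhedron_psd:
  fixes F :: "(real^'n^'n) set"
  assumes "convex F" "F \<subseteq> psd_cone" "a \<noteq> b"
    and v: "\<And>s. 0 < s \<Longrightarrow> self_outer (axis a 1 + s *\<^sub>R axis b 1) \<in> F"
  shows "\<not> polyhedron F"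
proof
  assume "polyhedron F"
  \<comment> \<open>Orthogonal to e_a + s e_b but to no other e_a + t e_b, so \<open>G s\<close>
    contains exactly one of the given rank-one matrices.\<close>
  define w where "w s = s *\<^sub>R axis a 1 - (axis b 1 :: real^'n)" for s
  define G where "G s = F \<inter> {A. self_outer (w s) \<bullet> A = 0}" for s
  have wv: "w s \<bullet> (axis a 1 + t *\<^sub>R axis b 1) = s - t" for s t
    using \<open>a \<noteq> b\<close> by (simp add: w_def inner_simps inner_axis_axis)
  have "G s face_of F" for s
    unfolding G_def using assms(1,2)
    by (intro face_of_Int_supporting_hyperplane_ge)
      (auto simp: psd_cone_def simp flip: quadratic_form_eq_inner)
  then have "G ` {0<..} \<subseteq> {F'. F' face_of F}"
    by auto
  then have "finite (G ` {0<..})"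
    using finite_polyhedron_faces[OF \<open>polyhedron F\<close>] finite_subset by blast
  moreover have "inj_on G {0<..}"
  proof (rule inj_onI)
    fix s t :: real assume st: "s \<in> {0<..}" "t \<in> {0<..}" "G s = G t"
    have "self_outer (axis a 1 + s *\<^sub>R axis b 1) \<in> G s"
      using v st(1) by (simp add: G_def inner_self_outer wv)
    then have "self_outer (axis a 1 + s *\<^sub>R axis b 1) \<in> G t"
      using st by simp
    then show "s = t"
      by (simp add: G_def inner_self_outer wv)
  qed
  ultimately have "finite {0::real<..}"
    by (rule finite_imageD)
  then show False
    by (simp add: infinite_Ioi)
qed

section \<open>Faces given by vanishing entries\<close>

text \<open>A set \<open>S\<close> of positions consists of sets \<open>{i, j}\<close>; a diagonal position is a singleton.\<close>

definition zero_face :: "(real^'n^'n) set \<Rightarrow> 'n set set \<Rightarrow> (real^'n^'n) set" where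
  "zero_face K S = {A \<in> K. \<forall>i j. {i, j} \<in> S \<longrightarrow> A $ i $ j = 0}"

text \<open>Two nonnegative entries with sum zero both vanish.\<close>

lemma cone_face_zero_face:
  assumes "convex K" "cone K" "0 \<in> K" "K \<subseteq> nonneg_mats"
  shows "cone_face (zero_face K S) K"
proof -
  have "0 \<in> zero_face K S"
    using \<open>0 \<in> K\<close> by (simp add: zero_face_def)
  moreover have "convex (zero_face K S)" "cone (zero_face K S)"
    using \<open>convex K\<close> \<open>cone K\<close> by (auto simp: zero_face_def convex_def cone_def)
  moreover have "A \<in> zero_face K S \<and> B \<in> zero_face K S"
    if AB: "A \<in> K" "B \<in> K" and "A + B \<in> zero_face K S" for A B
  proof -
    have "A $ i $ j = 0 \<and> B $ i $ j = 0" if "{i, j} \<in> S" for i j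
    proof -
      have "0 \<le> A $ i $ j" "0 \<le> B $ i $ j"
        using AB \<open>K \<subseteq> nonneg_mats\<close> by (auto simp: nonneg_mats_def)
      moreover have "A $ i $ j + B $ i $ j = 0"
        using \<open>A + B \<in> zero_face K S\<close> that by (auto simp: zero_face_def)
      ultimately show ?thesis
        by linarith
    qed
    then show ?thesis
      using AB by (simp add: zero_face_def)
  qed
  moreover have "zero_face K S \<subseteq> K"
    by (auto simp: zero_face_def)
  ultimately show ?thesis
    unfolding cone_face_def by blast
qed

text \<open>No position killed earlier is contained in a later one, so a witness supported on the
  block of the later position survives until its turn. Chains are indexed from 1: the
  \<open>i\<close>-th face kills \<open>i - 1\<close> positions, and the first face is
  \<open>K\<close>.\<close>

lemma face_chain_zero_face:
  assumes K: "convex K" "cone K" "0 \<in> K" "K \<subseteq> nonneg_mats" "cp_cone \<subseteq> K"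
    and xs: "sorted_wrt (\<lambda>s t. \<not> s \<subseteq> t) xs" "\<forall>s\<in>set xs. card s = 1 \<or> card s = 2"
    and l: "1 \<le> l" "l \<le> Suc (length xs)"
  shows "face_chain K l (\<lambda>i. zero_face K (set (take (i - 1) xs)))"
proof -
  have "zero_face K (set (take (Suc k) xs)) \<subset> zero_face K (set (take k xs))"
    if k: "k < length xs" for k
  proof -
    have "card (xs ! k) = 1 \<or> card (xs ! k) = 2"
      using xs k by auto
    then obtain i j where ij: "xs ! k = {i, j}"
      by (auto simp: card_1_singleton_iff card_2_iff)
    \<comment> \<open>The outer square of the indicator vector of \<open>xs ! k\<close>: completely
      positive, and nonzero exactly at the positions contained in \<open>xs ! k\<close>.\<close>
    define W where "W = self_outer (\<chi> p. if p \<in> xs ! k then 1 else (0::real))"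
    have W: "W $ p $ q = (if {p, q} \<subseteq> xs ! k then 1 else 0)" for p q
      by (simp add: W_def self_outer_def)
    have "W \<in> K"
      unfolding W_def
      by (intro subsetD[OF \<open>cp_cone \<subseteq> K\<close>] self_outer_in_cp_cone) (simp add: nonneg_vecs_def)
    moreover have "W $ p $ q = 0" if pq: "{p, q} \<in> set (take k xs)" for p q
    proof -
      obtain m where "m < k" "{p, q} = xs ! m"
        using pq k by (auto simp: in_set_conv_nth)
      then have "\<not> {p, q} \<subseteq> xs ! k"
        using sorted_wrt_nth_less[OF xs(1), of m k] k by simp
      then show ?thesis
        by (simp only: W if_False)
    qed
    ultimately have "W \<in> zero_face K (set (take k xs))"
      by (simp add: zero_face_def)
    moreover have "W \<notin> zero_face K (set (take (Suc k) xs))"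
    proof
      assume "W \<in> zero_face K (set (take (Suc k) xs))"
      then have "W $ i $ j = 0"
        using k ij by (auto simp: zero_face_def take_Suc_conv_app_nth)
      then show False
        by (simp add: W ij)
    qed
    moreover have "zero_face K (set (take (Suc k) xs)) \<subseteq> zero_face K (set (take k xs))"
      using k by (auto simp: zero_face_def take_Suc_conv_app_nth)
    ultimately show ?thesis
      by blast
  qed
  then have "zero_face K (set (take (Suc i - 1) xs)) \<subset> zero_face K (set (take (i - 1) xs))"
    if "i \<in> {1..<l}" for i
    using that l by (cases i) auto
  then show ?thesis
    unfolding face_chain_def using \<open>1 \<le> l\<close> cone_face_zero_face[OF K(1-4)] by blast
qed

section \<open>Orderings of the positions\<close>

lemma sorted_wrt_not_subset_card:
  assumes "\<forall>s\<in>A. card s = c" and "finite A" and "0 < c"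
  obtains xs where "set xs = A" "sorted_wrt (\<lambda>s t. \<not> s \<subseteq> t) xs"
proof -
  obtain xs where xs: "set xs = A" "distinct xs"
    using finite_distinct_list[OF \<open>finite A\<close>] by blast
  \<comment> \<open>Different finite sets of equal size are never nested; \<open>0 < c\<close>
    guarantees finiteness, as infinite sets have \<open>card\<close> 0.\<close>
  have "\<not> s \<subseteq> t" if "s \<in> A" "t \<in> A" "s \<noteq> t" for s t
    using that assms by (metis card_gt_0_iff card_subset_eq)
  then have "sorted_wrt (\<lambda>s t. \<not> s \<subseteq> t) xs"
    using xs by (auto simp: sorted_wrt_iff_nth_less nth_eq_iff_index_eq)
  then show ?thesis
    using that xs by blast
qed

lemma distinct_sorted_wrt_not_subset: "sorted_wrt (\<lambda>s t. \<not> s \<subseteq> t) xs \<Longrightarrow> distinct xs"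
  by (induction xs) auto

lemma singleton_pair_order:
  assumes "\<forall>s\<in>set es. card s = 2" "\<forall>s\<in>set ds. card s = 1" "s \<in> set es" "t \<in> set ds"
  shows "\<not> (s :: 'n::finite set) \<subseteq> t"
proof
  assume "s \<subseteq> t"
  then have "card s \<le> card t"
    by (simp add: card_mono)
  then show False
    using assms by auto
qed

text \<open>Listing all pairs before all singletons works, since a pair never fits into a
  singleton.\<close>

lemma enumerate_positions:
  obtains xs :: "'n::finite set list" where "set xs = {s. card s = 1 \<or> card s = 2}"
    "sorted_wrt (\<lambda>s t. \<not> s \<subseteq> t) xs"
proof -
  obtain es :: "'n set list"
    where es: "set es = {s. card s = 2}" "sorted_wrt (\<lambda>s t. \<not> s \<subseteq> t) es"
    by (rule sorted_wrt_not_subset_card[of "{s :: 'n set. card s = 2}" 2]) auto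
  obtain ds :: "'n set list"
    where ds: "set ds = {s. card s = 1}" "sorted_wrt (\<lambda>s t. \<not> s \<subseteq> t) ds"
    by (rule sorted_wrt_not_subset_card[of "{s :: 'n set. card s = 1}" 1]) auto
  have "set (es @ ds) = {s. card s = 1 \<or> card s = 2}"
    using es(1) ds(1) by auto
  moreover have "\<not> s \<subseteq> t" if "s \<in> set es" "t \<in> set ds" for s t
    using that es(1) ds(1) by (intro singleton_pair_order[of es ds]) auto
  then have "sorted_wrt (\<lambda>s t. \<not> s \<subseteq> t) (es @ ds)"
    using es(2) ds(2) by (simp add: sorted_wrt_append)
  ultimately show ?thesis
    by (rule that)
qed

text \<open>Keeps the 2x2 block of \<open>a\<close> and \<open>b\<close> for the end. The pair
  \<open>{a, b}\<close> may follow the other singletons because none of them is contained in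
  it.\<close>

lemma enumerate_positions_ending:
  assumes "a \<noteq> b"
  obtains ys :: "'n::finite set list"
  where "set (ys @ [{a, b}, {a}, {b}]) = {s. card s = 1 \<or> card s = 2}"
    "sorted_wrt (\<lambda>s t. \<not> s \<subseteq> t) (ys @ [{a, b}, {a}, {b}])"
proof -
  obtain es :: "'n set list"
    where es: "set es = {s. card s = 2} - {{a, b}}" "sorted_wrt (\<lambda>s t. \<not> s \<subseteq> t) es"
    by (rule sorted_wrt_not_subset_card[of "{s :: 'n set. card s = 2} - {{a, b}}" 2]) auto
  obtain ds :: "'n set list"
    where ds: "set ds = {s. card s = 1} - {{a}, {b}}" "sorted_wrt (\<lambda>s t. \<not> s \<subseteq> t) ds"
    by (rule sorted_wrt_not_subset_card[of "{s :: 'n set. card s = 1} - {{a}, {b}}" 1]) auto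
  have ab: "card {a, b} = 2"
    using \<open>a \<noteq> b\<close> by simp
  have set_eq: "set ((es @ ds) @ [{a, b}, {a}, {b}]) = {s. card s = 1 \<or> card s = 2}"
    using ab by (auto simp: es ds)
  have "\<not> s \<subseteq> {a, b}" if "s \<in> set es" for s
    using that ab by (metis (mono_tags, lifting) DiffD1 DiffD2 card_subset_eq es(1) finite
        insertI1 mem_Collect_eq)
  moreover have "\<not> s \<subseteq> {c}" if "s \<in> set es" for s c
    using that singleton_pair_order[of es "[{c}]" s "{c}"] es by auto
  moreover have "\<not> s \<subseteq> {a, b}" if "s \<in> set ds" for s
    using that ds(1) by (auto simp: card_1_singleton_iff)
  moreover have "\<not> s \<subseteq> {c}" if "s \<in> set ds" "c = a \<or> c = b" for s c
    using that ds(1) by (auto simp: card_1_singleton_iff)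
  moreover have "\<not> s \<subseteq> t" if "s \<in> set es" "t \<in> set ds" for s t
    using that es(1) ds(1) by (intro singleton_pair_order[of es ds]) auto
  ultimately have "sorted_wrt (\<lambda>s t. \<not> s \<subseteq> t) ((es @ ds) @ [{a, b}, {a}, {b}])"
    using es(2) ds(2) \<open>a \<noteq> b\<close> by (auto simp: sorted_wrt_append)
  with set_eq show ?thesis
    by (rule that)
qed

section \<open>Cones between the completely positive and the doubly nonnegative cone\<close>

theorem corollary3p3:
  fixes K :: "(real^'n^'n) set"
  assumes "closed K" and "convex K" and "cone K"
    and "K \<subseteq> sym_mats"
    and "cp_cone \<subseteq> K" and "K \<subseteq> dnn_cone"
  shows "longest_chain K = enat (triangular CARD('n) + 1) \<and>
    poly_distance K = (if CARD('n) = 1 then 0 else enat (triangular CARD('n) - 2))"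
proof -
  let ?T = "triangular CARD('n)"
  have nonneg: "K \<subseteq> nonneg_mats" and psd: "K \<subseteq> psd_cone"
    using \<open>K \<subseteq> dnn_cone\<close> by (auto simp: dnn_cone_def)
  have "self_outer 0 \<in> K"
    using \<open>cp_cone \<subseteq> K\<close> self_outer_in_cp_cone[of 0] by (auto simp: nonneg_vecs_def)
  moreover have "self_outer 0 = (0 :: real^'n^'n)"
    by (simp add: self_outer_def vec_eq_iff)
  ultimately have "0 \<in> K"
    by simp
  note chain = face_chain_zero_face[OF \<open>convex K\<close> \<open>cone K\<close> \<open>0 \<in> K\<close> nonneg \<open>cp_cone \<subseteq> K\<close>]
  have dim: "aff_dim (F (Suc i)) + int i \<le> int ?T" if "face_chain K l F" "Suc i \<le> l" for l F i
  proof -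
    have "aff_dim (F (Suc i)) + int i \<le> aff_dim K"
      by (rule face_chain_aff_dim[OF \<open>convex K\<close> \<open>cone K\<close> that])
    also have "\<dots> \<le> aff_dim (sym_mats :: (real^'n^'n) set)"
      by (rule aff_dim_subset[OF \<open>K \<subseteq> sym_mats\<close>])
    also have "\<dots> \<le> int ?T"
      by (rule aff_dim_sym_mats)
    finally show ?thesis .
  qed
  have poly: "polyhedron F" if F: "cone_face F K" and "aff_dim F \<le> 2" for F
  proof (rule polyhedron_cone_aff_dim_le_2[OF _ _ _ _ that(2)])
    show "closed F"
      using cone_face_imp_face_of[OF \<open>cone K\<close> F] face_of_imp_closed \<open>convex K\<close> \<open>closed K\<close> by blast
    show "convex F" "cone F"
      using F by (auto simp: cone_face_def)
    show "norm A \<le> (\<chi> i j. 1) \<bullet> A" if "A \<in> F" for A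
      using that F nonneg by (intro norm_le_sum_entries) (auto simp: cone_face_def)
  qed
  have "longest_chain K = enat (?T + 1)"
    unfolding longest_chain_def
  proof (rule antisym)
    show "Sup {enat l |l. \<exists>F. face_chain K l F} \<le> enat (?T + 1)"
    proof (rule Sup_least, clarify)
      fix l F assume F: "face_chain K l F"
      then obtain i where i: "l = Suc i"
        by (cases l) (auto simp: face_chain_def)
      then have "F l \<noteq> {}"
        using F by (auto simp: face_chain_def cone_face_def)
      \<comment> \<open>Only the empty set has dimension -1, and faces are nonempty.\<close>
      then have "0 \<le> aff_dim (F l)"
        using aff_dim_geq[of "F l"] aff_dim_empty[of "F l"] by linarith
      then show "enat l \<le> enat (?T + 1)"
        using dim[OF F, of i] i by simp
    qed
    obtain xs :: "'n set list" where xs: "set xs = {s. card s = 1 \<or> card s = 2}"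
      "sorted_wrt (\<lambda>s t. \<not> s \<subseteq> t) xs"
      by (rule enumerate_positions)
    have "length xs = ?T"
      using distinct_card[OF distinct_sorted_wrt_not_subset[OF xs(2)]] xs(1) card_positions by metis
    then have "\<exists>F. face_chain K (?T + 1) F"
      using chain[OF xs(2), of "?T + 1"] xs(1) by auto
    then show "enat (?T + 1) \<le> Sup {enat l |l. \<exists>F. face_chain K l F}"
      by (intro Sup_upper) auto
  qed
  moreover have "poly_distance K = (if CARD('n) = 1 then 0 else enat (?T - 2))"
  proof -
    let ?L = "{enat l |l. \<exists>F. face_chain K l F \<and> polyhedron (F l) \<and> (\<forall>i\<in>{1..<l}. \<not> polyhedron (F i))}"
    have upper: "l \<le> 1 \<or> Suc l \<le> ?T"
      if F: "face_chain K l F" and np: "\<forall>i\<in>{1..<l}. \<not> polyhedron (F i)" for l F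
    proof (cases "l \<le> 1")
      case False
      \<comment> \<open>The next-to-last face is \<open>F (Suc i)\<close>. It is not polyhedral, so
        its dimension is at least 3, and \<open>i\<close> inclusions precede it: 3 + (l - 2) is at
        most \<open>?T\<close>.\<close>
      define i where "i = l - 2"
      have l: "l = Suc (Suc i)"
        using False by (simp add: i_def)
      have "cone_face (F (Suc i)) K"
        using F l by (simp add: face_chain_def)
      moreover have "\<not> polyhedron (F (Suc i))"
        using np l by simp
      ultimately have "2 < aff_dim (F (Suc i))"
        using poly by force
      then show ?thesis
        using dim[OF F, of i] l by simp
    qed simp
    show ?thesis
    proof (cases "CARD('n) = 1")
      case True
      then have "?T = 1"
        by (simp add: triangular_def)
      have "Sup ?L \<le> enat 1"
      proof (rule Sup_least, clarify)
        fix l F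
        assume "face_chain K l F" "\<forall>i\<in>{1..<l}. \<not> polyhedron (F i)"
        then show "enat l \<le> enat 1"
          using upper \<open>?T = 1\<close> by fastforce
      qed
      \<comment> \<open>Subtraction on \<open>enat\<close> truncates at 0, so the upper bound 1
        suffices.\<close>
      then have "poly_distance K = 0"
        unfolding poly_distance_def by (cases "Sup ?L") (auto simp: one_enat_def zero_enat_def)
      then show ?thesis
        using True by simp
    next
      case False
      then have "\<not> is_singleton (UNIV :: 'n set)"
        by (simp add: is_singleton_altdef)
      then obtain a b :: 'n where ab: "a \<noteq> b"
        by (metis UNIV_I is_singletonI' empty_iff)
      obtain ys where ys: "set (ys @ [{a, b}, {a}, {b}]) = {s. card s = 1 \<or> card s = 2}"
        "sorted_wrt (\<lambda>s t. \<not> s \<subseteq> t) (ys @ [{a, b}, {a}, {b}])"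
        by (rule enumerate_positions_ending[OF ab])
      define xs where "xs = ys @ [{a, b}, {a}, {b}]"
      have "length xs = ?T"
        using distinct_card[OF distinct_sorted_wrt_not_subset[OF ys(2)]] ys(1) card_positions
        unfolding xs_def by metis
      then have T: "?T = length ys + 3"
        by (simp add: xs_def)
      \<comment> \<open>The last face \<open>F ?l\<close> has killed \<open>ys\<close> and
        \<open>{a, b}\<close>, leaving only the diagonal positions of \<open>a\<close> and
        \<open>b\<close>. As \<open>?T\<close> is \<open>length ys + 3\<close>, the distance
        \<open>?l - 1\<close> equals \<open>?T - 2\<close>.\<close>
      let ?l = "length ys + 2"
      define F where "F = (\<lambda>i. zero_face K (set (take (i - 1) xs)))"
      have F: "face_chain K ?l F"
        unfolding F_def xs_def using ys(1) by (intro chain[OF ys(2)]) auto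
      have "polyhedron (F ?l)"
      proof (rule poly)
        show "cone_face (F ?l) K"
          using F by (auto simp: face_chain_def)
        show "aff_dim (F ?l) \<le> 2"
          using dim[OF F, of "Suc (length ys)"] T by simp
      qed
      moreover have "\<not> polyhedron (F i)" if i: "i \<in> {1..<?l}" for i
      proof (rule not_polyhedron_psd[OF _ _ ab])
        have "cone_face (F i) K"
          using F i by (simp add: face_chain_def)
        then show "convex (F i)" "F i \<subseteq> psd_cone"
          using psd by (auto simp: cone_face_def)
        fix s :: real assume "0 < s"
        let ?v = "axis a 1 + s *\<^sub>R axis b 1 :: real^'n"
        have "self_outer ?v \<in> K"
          using \<open>0 < s\<close> by (intro subsetD[OF \<open>cp_cone \<subseteq> K\<close>] self_outer_in_cp_cone)
            (simp add: nonneg_vecs_def axis_def)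
        moreover have "self_outer ?v $ p $ q = 0" if "{p, q} \<in> set (take (i - 1) xs)" for p q
        proof -
          \<comment> \<open>Before the last face \<open>i - 1\<close> is at most
            \<open>length ys\<close>, so no position of the block of \<open>a\<close> and
            \<open>b\<close> has been killed.\<close>
          have "{p, q} \<in> set ys"
            using that i in_set_takeD[of "{p, q}" "i - 1" ys] by (auto simp: xs_def)
          moreover have "\<forall>s\<in>set ys. \<not> s \<subseteq> {a, b}"
            using ys(2) by (simp add: sorted_wrt_append)
          ultimately have "\<not> {p, q} \<subseteq> {a, b}"
            by (rule bspec[rotated])
          then have "p \<notin> {a, b} \<or> q \<notin> {a, b}"
            by simp
          then have "?v $ p = 0 \<or> ?v $ q = 0"
            by (auto simp: axis_def)
          then show ?thesis
            by (simp only: self_outer_def vec_lambda_beta mult_eq_0_iff)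
        qed
        ultimately show "self_outer ?v \<in> F i"
          by (simp add: F_def zero_face_def)
      qed
      ultimately have "enat ?l \<le> Sup ?L"
        using F by (intro Sup_upper) blast
      moreover have "Sup ?L \<le> enat ?l"
      proof (rule Sup_least, clarify)
        fix l G
        assume "face_chain K l G" "\<forall>i\<in>{1..<l}. \<not> polyhedron (G i)"
        then show "enat l \<le> enat ?l"
          using upper T by fastforce
      qed
      ultimately have "Sup ?L = enat ?l"
        by (rule antisym[rotated])
      then show ?thesis
        using False T by (simp add: poly_distance_def one_enat_def)
    qed
  qed
  ultimately show ?thesis
    by blast
qed

end
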